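(* Let $S$ be an intra-regular LA-semigroup with left identity and let $Q$ be a nonempty subset of $S$. Then the following conditions are equivalent: (i) $Q$ is a quasi ideal of $S$; (ii) $SQ\cap QS=Q$.
   Context: An LA-semigroup (left almost semigroup) is a nonempty set $S$ with a binary operation, written as juxtaposition, satisfying the left invertive law $(ab)c=(cb)a$ for all $a,b,c\in S$ (associativity and commutativity are not assumed). A left identity is an element $e\in S$ with $ea=a$ for all $a\in S$. For subsets $A,B\subseteq S$, $AB=\{ab: a\in A,\ b\in B\}$. A nonempty subset $Q\subseteq S$ is a quasi ideal if $SQ\cap QS\subseteq Q$. $S$ is intra-regular if for every $a\in S$ there exist $x,y\in S$ such that $a=(xa^{2})y$, where $a^2=aa$. *)

theory Defs
  imports Main
begin

locale la_semigroup =
  fixes S :: "'a set" and mul :: "'a \<Rightarrow> 'a \<Rightarrow> 'a"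
  assumes nonempty: "S \<noteq> {}"
    and closed: "\<lbrakk>a \<in> S; b \<in> S\<rbrakk> \<Longrightarrow> mul a b \<in> S"
    and left_invertive: "\<lbrakk>a \<in> S; b \<in> S; c \<in> S\<rbrakk> \<Longrightarrow> mul (mul a b) c = mul (mul c b) a"

definition left_identity :: "'a set \<Rightarrow> ('a \<Rightarrow> 'a \<Rightarrow> 'a) \<Rightarrow> 'a \<Rightarrow> bool" where
  "left_identity S mul e \<longleftrightarrow> e \<in> S \<and> (\<forall>a\<in>S. mul e a = a)"

definition set_mul :: "('a \<Rightarrow> 'a \<Rightarrow> 'a) \<Rightarrow> 'a set \<Rightarrow> 'a set \<Rightarrow> 'a set" where
  "set_mul mul A B = {mul a b | a b. a \<in> A \<and> b \<in> B}"

definition quasi_ideal :: "'a set \<Rightarrow> ('a \<Rightarrow> 'a \<Rightarrow> 'a) \<Rightarrow> 'a set \<Rightarrow> bool" where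
  "quasi_ideal S mul Q \<longleftrightarrow>
     Q \<subseteq> S \<and> Q \<noteq> {} \<and> set_mul mul S Q \<inter> set_mul mul Q S \<subseteq> Q"

definition intra_regular :: "'a set \<Rightarrow> ('a \<Rightarrow> 'a \<Rightarrow> 'a) \<Rightarrow> bool" where
  "intra_regular S mul \<longleftrightarrow>
     (\<forall>a\<in>S. \<exists>x\<in>S. \<exists>y\<in>S. a = mul (mul x (mul a a)) y)"

end

theory Submission
  imports Defs
begin

text \<open>
  The inclusion that needs proof is \<open>Q \<subseteq> SQ \<inter> QS\<close>, and it holds for every subset \<open>Q\<close>,
  because each element \<open>a\<close> lies in \<open>Sa\<close> and in \<open>aS\<close>. The former is \<open>a = ea\<close>. Since a left
  identity need not be a right identity, the latter is where intra-regularity enters: the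
  medial law and left commutativity move \<open>a\<^sup>2\<close> to the front of \<open>a = (xa\<^sup>2)y\<close>, giving
  \<open>a = a\<^sup>2t\<close>, and then take out a single left factor,
  \<open>a = (aa)(et) = (ae)(at) = a((ae)t)\<close>.
\<close>

context la_semigroup
begin

lemma medial:
  assumes "a \<in> S" "b \<in> S" "c \<in> S" "d \<in> S"
  shows "mul (mul a b) (mul c d) = mul (mul a c) (mul b d)"
proof -
  have "mul (mul a b) (mul c d) = mul (mul (mul c d) b) a"
    using assms by (intro left_invertive) (simp_all add: closed)
  also have "\<dots> = mul (mul (mul b d) c) a"
    using assms by (simp add: left_invertive[of c d b])
  also have "\<dots> = mul (mul a c) (mul b d)"
    using assms by (intro left_invertive) (simp_all add: closed)
  finally show ?thesis .
qed

lemma left_commute: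
  assumes e: "left_identity S mul e" and abc: "a \<in> S" "b \<in> S" "c \<in> S"
  shows "mul a (mul b c) = mul b (mul a c)"
  using medial[of e a b c] e abc by (simp add: left_identity_def)

text \<open>
  The left identity serves twice as a dummy factor: writing \<open>y = ey\<close> and \<open>t = et\<close> creates
  the products of pairs on which the medial law can act.
\<close>

lemma intra_regular_right_multiple:
  assumes e: "left_identity S mul e" and reg: "intra_regular S mul" and a: "a \<in> S"
  shows "\<exists>s\<in>S. a = mul a s"
proof -
  have eS: "e \<in> S" and idl: "\<And>z. z \<in> S \<Longrightarrow> mul e z = z"
    using e by (auto simp: left_identity_def)
  obtain x y where x: "x \<in> S" and y: "y \<in> S" and axy: "a = mul (mul x (mul a a)) y"
    using reg a unfolding intra_regular_def by blast
  define t where "t = mul (mul x e) y"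
  have t: "t \<in> S"
    using x y eS by (simp add: t_def closed)
  have "a = mul (mul x (mul a a)) (mul e y)"
    using axy y by (simp add: idl)
  also have "\<dots> = mul (mul x e) (mul (mul a a) y)"
    using x y a eS by (simp add: medial closed)
  also have "\<dots> = mul (mul a a) t"
    unfolding t_def using x y a eS by (intro left_commute[OF e]) (simp_all add: closed)
  also have "\<dots> = mul (mul a a) (mul e t)"
    using t by (simp add: idl)
  also have "\<dots> = mul (mul a e) (mul a t)"
    using a t eS by (intro medial)
  also have "\<dots> = mul a (mul (mul a e) t)"
    using a t eS by (intro left_commute[OF e]) (simp_all add: closed)
  finally show ?thesis
    using a t eS closed by blast
qed

end

theorem theorem9:
  fixes S :: "'a set" and mul :: "'a \<Rightarrow> 'a \<Rightarrow> 'a" and Q :: "'a set"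
  assumes "la_semigroup S mul"
    and "\<exists>e. left_identity S mul e"
    and "intra_regular S mul"
    and "Q \<subseteq> S" and "Q \<noteq> {}"
  shows "quasi_ideal S mul Q \<longleftrightarrow> set_mul mul S Q \<inter> set_mul mul Q S = Q"
proof -
  obtain e where e: "left_identity S mul e"
    using assms(2) by blast
  have "Q \<subseteq> set_mul mul S Q \<inter> set_mul mul Q S"
  proof
    fix q assume q: "q \<in> Q"
    then have "q \<in> S"
      using assms(4) by blast
    then have "q = mul e q" "e \<in> S"
      using e by (auto simp: left_identity_def)
    moreover obtain s where "s \<in> S" "q = mul q s"
      using la_semigroup.intra_regular_right_multiple[OF assms(1) e assms(3) \<open>q \<in> S\<close>] by blast
    ultimately show "q \<in> set_mul mul S Q \<inter> set_mul mul Q S"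
      using q unfolding set_mul_def by blast
  qed
  then show ?thesis
    using assms(4,5) unfolding quasi_ideal_def by blast
qed

end
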